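(* Let $(A,\mu,\alpha,\beta)$ be a BiHom-Jordan algebra and let $I$ be a two-sided BiHom-ideal of $(A,\mu,\alpha,\beta)$. Then $(A/I,\overline{\mu},\overline{\alpha},\overline{\beta})$ is a BiHom-Jordan algebra, where $\overline{\mu}(\overline{x},\overline{y})=\overline{\mu(x,y)}$, $\overline{\alpha}(\overline{x})=\overline{\alpha(x)}$ and $\overline{\beta}(\overline{x})=\overline{\beta(x)}$ for all $\overline{x},\overline{y}\in A/I$.
   Context: $\mathbb{K}$ is an algebraically closed field of characteristic $0$; all vector spaces and (multi)linear maps are over $\mathbb{K}$. A BiHom-algebra $(A,\mu,\alpha,\beta)$ is a vector space $A$ with a bilinear map $\mu:A\times A\to A$ and linear maps $\alpha,\beta:A\to A$ with $\alpha\beta=\beta\alpha$. It is multiplicative if $\alpha(\mu(x,y))=\mu(\alpha(x),\alpha(y))$ and $\beta(\mu(x,y))=\mu(\beta(x),\beta(y))$ for all $x,y\in A$. Its BiHom-associator is $as_{\alpha,\beta}(x,y,z)=\mu(\mu(x,y),\beta(z))-\mu(\alpha(x),\mu(y,z))$. A BiHom-Jordan algebra is a multiplicative BiHom-algebra such that for all $x,y\in A$: $\mu(\beta(x),\alpha(y))=\mu(\beta(y),\alpha(x))$ and $as_{\alpha,\beta}\big(\mu(\beta^2(x),\alpha\beta(x)),\alpha^2\beta(y),\alpha^3(x)\big)=0$. A BiHom-subalgebra of $(A,\mu,\alpha,\beta)$ is a linear subspace $H$ with $\mu(x,y),\alpha(x),\beta(x)\in H$ for all $x,y\in H$. If moreover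 $\mu(a,b)\in H$ and $\mu(b,a)\in H$ for all $(a,b)\in A\times H$, then $H$ is called a two-sided BiHom-ideal. *)

theory Defs
  imports "HOL-Algebra.Algebra"
begin

section \<open>Linear and bilinear maps\<close>

definition linear_maps ::
    "('k, 'l) ring_scheme \<Rightarrow> ('k, 'a, 'm) module_scheme \<Rightarrow> ('k, 'b, 'n) module_scheme \<Rightarrow> ('a \<Rightarrow> 'b) set"
  where "linear_maps K V W =
    {f \<in> carrier V \<rightarrow> carrier W.
      (\<forall>x\<in>carrier V. \<forall>y\<in>carrier V. f (x \<oplus>\<^bsub>V\<^esub> y) = f x \<oplus>\<^bsub>W\<^esub> f y) \<and>
      (\<forall>c\<in>carrier K. \<forall>x\<in>carrier V. f (c \<odot>\<^bsub>V\<^esub> x) = c \<odot>\<^bsub>W\<^esub> f x)}"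

definition bilinear_maps ::
    "('k, 'l) ring_scheme \<Rightarrow> ('k, 'a, 'm) module_scheme \<Rightarrow> ('k, 'b, 'n) module_scheme
      \<Rightarrow> ('k, 'c, 'o) module_scheme \<Rightarrow> ('a \<Rightarrow> 'b \<Rightarrow> 'c) set"
  where "bilinear_maps K U V W =
    {f. (\<forall>x\<in>carrier U. f x \<in> linear_maps K V W) \<and>
        (\<forall>y\<in>carrier V. (\<lambda>x. f x y) \<in> linear_maps K U W)}"


section \<open>BiHom-Jordan algebras\<close>

text \<open>The vector space is a module over a field; the fields \<open>mult\<close> and \<open>one\<close> that the
  record type \<open>module\<close> inherits from rings play no role, and the product is the separate
  parameter \<open>\<mu>\<close>.\<close>

locale bihom_algebra = K?: field K + A?: module K A
  for K :: "('k, 'l) ring_scheme" (structure) and A :: "('k, 'a, 'm) module_scheme" (structure) +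
  fixes \<mu> :: "'a \<Rightarrow> 'a \<Rightarrow> 'a" and \<alpha> :: "'a \<Rightarrow> 'a" and \<beta> :: "'a \<Rightarrow> 'a"
  assumes mu_bilinear: "\<mu> \<in> bilinear_maps K A A A"
    and alpha_linear: "\<alpha> \<in> linear_maps K A A"
    and beta_linear: "\<beta> \<in> linear_maps K A A"
    and alpha_beta_commute: "x \<in> carrier A \<Longrightarrow> \<alpha> (\<beta> x) = \<beta> (\<alpha> x)"

locale multiplicative_bihom_algebra = bihom_algebra +
  assumes alpha_mult: "\<lbrakk>x \<in> carrier A; y \<in> carrier A\<rbrakk> \<Longrightarrow> \<alpha> (\<mu> x y) = \<mu> (\<alpha> x) (\<alpha> y)"
    and beta_mult: "\<lbrakk>x \<in> carrier A; y \<in> carrier A\<rbrakk> \<Longrightarrow> \<beta> (\<mu> x y) = \<mu> (\<beta> x) (\<beta> y)"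

definition bihom_associator ::
    "('k, 'a, 'm) module_scheme \<Rightarrow> ('a \<Rightarrow> 'a \<Rightarrow> 'a) \<Rightarrow> ('a \<Rightarrow> 'a) \<Rightarrow> ('a \<Rightarrow> 'a) \<Rightarrow> 'a \<Rightarrow> 'a \<Rightarrow> 'a \<Rightarrow> 'a"
  where "bihom_associator A \<mu> \<alpha> \<beta> x y z = \<mu> (\<mu> x y) (\<beta> z) \<ominus>\<^bsub>A\<^esub> \<mu> (\<alpha> x) (\<mu> y z)"

locale bihom_jordan_algebra = multiplicative_bihom_algebra +
  assumes bihom_commutative:
      "\<lbrakk>x \<in> carrier A; y \<in> carrier A\<rbrakk> \<Longrightarrow> \<mu> (\<beta> x) (\<alpha> y) = \<mu> (\<beta> y) (\<alpha> x)"
    and bihom_jordan_identity: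
      "\<lbrakk>x \<in> carrier A; y \<in> carrier A\<rbrakk> \<Longrightarrow>
        bihom_associator A \<mu> \<alpha> \<beta> (\<mu> (\<beta> (\<beta> x)) (\<alpha> (\<beta> x))) (\<alpha> (\<alpha> (\<beta> y))) (\<alpha> (\<alpha> (\<alpha> x)))
          = \<zero>\<^bsub>A\<^esub>"


section \<open>BiHom-ideals\<close>

locale bihom_subalgebra = submodule H K A
  for H and K :: "('k, 'l) ring_scheme" and A :: "('k, 'a, 'm) module_scheme" (structure)
    and \<mu> :: "'a \<Rightarrow> 'a \<Rightarrow> 'a" and \<alpha> :: "'a \<Rightarrow> 'a" and \<beta> :: "'a \<Rightarrow> 'a" +
  assumes mu_closed: "\<lbrakk>x \<in> H; y \<in> H\<rbrakk> \<Longrightarrow> \<mu> x y \<in> H"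
    and alpha_closed: "x \<in> H \<Longrightarrow> \<alpha> x \<in> H"
    and beta_closed: "x \<in> H \<Longrightarrow> \<beta> x \<in> H"

locale two_sided_bihom_ideal = bihom_subalgebra +
  assumes mu_ideal_left: "\<lbrakk>a \<in> carrier A; b \<in> H\<rbrakk> \<Longrightarrow> \<mu> a b \<in> H"
    and mu_ideal_right: "\<lbrakk>a \<in> carrier A; b \<in> H\<rbrakk> \<Longrightarrow> \<mu> b a \<in> H"


section \<open>Quotients\<close>

text \<open>As for \<^const>\<open>rcoset_mult\<close>, an operation is induced on cosets by taking the union of the
  cosets of its values at all representatives. This union is a single coset exactly when the
  values at any two choices of representatives are congruent modulo \<open>I\<close>.\<close>

definition coset_map ::
    "('a, 'm) ring_scheme \<Rightarrow> 'a set \<Rightarrow> ('a \<Rightarrow> 'a) \<Rightarrow> 'a set \<Rightarrow> 'a set"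
  where "coset_map A I f U = (\<Union>x\<in>U. I +>\<^bsub>A\<^esub> f x)"

definition coset_map2 ::
    "('a, 'm) ring_scheme \<Rightarrow> 'a set \<Rightarrow> ('a \<Rightarrow> 'a \<Rightarrow> 'a) \<Rightarrow> 'a set \<Rightarrow> 'a set \<Rightarrow> 'a set"
  where "coset_map2 A I f U V = (\<Union>x\<in>U. \<Union>y\<in>V. I +>\<^bsub>A\<^esub> f x y)"

text \<open>The first five fields are those of \<^term>\<open>A Quot I\<close>; \<open>mult\<close> and \<open>one\<close> are
  irrelevant here.\<close>

definition quotient_module ::
    "('k, 'a, 'm) module_scheme \<Rightarrow> 'a set \<Rightarrow> ('k, 'a set) module"
  where "quotient_module A I =
    \<lparr>carrier = a_rcosets\<^bsub>A\<^esub> I, monoid.mult = rcoset_mult A I, one = I +>\<^bsub>A\<^esub> \<one>\<^bsub>A\<^esub>,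
      ring.zero = I, add = set_add A, smult = (\<lambda>c. coset_map A I (smult A c))\<rparr>"

end

theory Submission
  imports Defs
begin

text \<open>The projection of \<open>A\<close> onto its cosets is surjective, and every operation
  involved descends along it: changing a representative changes the value of
  \<open>\<alpha>\<close>, \<open>\<beta>\<close> or \<open>\<mu>\<close> only by an element of
  \<open>I\<close>, because \<open>I\<close> is stable under \<open>\<alpha>\<close> and
  \<open>\<beta>\<close> and absorbs products from both sides. Each axiom is an identity built from
  these operations and subtraction, so after writing every coset as that of a representative it
  becomes the coset of an identity already valid in \<open>A\<close>.

  Since the induced operations are unions of cosets, the weight lies on
  \<open>coset_map_rcos\<close> and \<open>coset_map2_rcos\<close>, which collapse such a union to
  one coset. \<open>quotient_is_module\<close> supplies the vector space structure, and
  \<open>rcos_minus\<close> lets the projection commute with the difference in the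
  BiHom-associator.\<close>

lemma linear_mapsI:
  assumes "\<And>x. x \<in> carrier V \<Longrightarrow> f x \<in> carrier W"
    and "\<And>x y. \<lbrakk>x \<in> carrier V; y \<in> carrier V\<rbrakk> \<Longrightarrow> f (x \<oplus>\<^bsub>V\<^esub> y) = f x \<oplus>\<^bsub>W\<^esub> f y"
    and "\<And>c x. \<lbrakk>c \<in> carrier K; x \<in> carrier V\<rbrakk> \<Longrightarrow> f (c \<odot>\<^bsub>V\<^esub> x) = c \<odot>\<^bsub>W\<^esub> f x"
  shows "f \<in> linear_maps K V W"
  using assms by (simp add: linear_maps_def)

lemma linear_mapsD:
  assumes "f \<in> linear_maps K V W"
  shows "x \<in> carrier V \<Longrightarrow> f x \<in> carrier W"
    and "\<lbrakk>x \<in> carrier V; y \<in> carrier V\<rbrakk> \<Longrightarrow> f (x \<oplus>\<^bsub>V\<^esub> y) = f x \<oplus>\<^bsub>W\<^esub> f y"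
    and "\<lbrakk>c \<in> carrier K; x \<in> carrier V\<rbrakk> \<Longrightarrow> f (c \<odot>\<^bsub>V\<^esub> x) = c \<odot>\<^bsub>W\<^esub> f x"
  using assms by (auto simp: linear_maps_def)

lemma bilinear_mapsD:
  assumes "f \<in> bilinear_maps K U V W"
  shows "x \<in> carrier U \<Longrightarrow> f x \<in> linear_maps K V W"
    and "y \<in> carrier V \<Longrightarrow> (\<lambda>x. f x y) \<in> linear_maps K U W"
  using assms by (auto simp: bilinear_maps_def)

context abelian_subgroup
begin

lemma a_rcosE:
  assumes "U \<in> a_rcosets H"
  obtains x where "x \<in> carrier G" "U = H +> x"
  using assms by (auto simp: A_RCOSETS_def')

text \<open>Two representatives differ by some \<open>h\<close> in \<open>H\<close>, and additivity
  turns this into a difference \<open>f h\<close>, again in \<open>H\<close>. Asking only for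
  additivity lets one lemma serve linear maps, scalar multiplications and the partial maps of a
  bilinear map.\<close>

lemma coset_map_rcos:
  assumes closed: "\<And>x. x \<in> carrier G \<Longrightarrow> f x \<in> carrier G"
    and add: "\<And>x y. \<lbrakk>x \<in> carrier G; y \<in> carrier G\<rbrakk> \<Longrightarrow> f (x \<oplus> y) = f x \<oplus> f y"
    and H: "\<And>h. h \<in> H \<Longrightarrow> f h \<in> H"
    and x: "x \<in> carrier G"
  shows "coset_map G H f (H +> x) = H +> f x"
proof -
  have "H +> f y = H +> f x" if "y \<in> H +> x" for y
  proof -
    obtain h where h: "h \<in> H" "y = h \<oplus> x"
      using \<open>y \<in> H +> x\<close> by (auto simp: a_r_coset_def')
    then have "f y = f h \<oplus> f x"
      using x by (simp add: add)
    then have "f y \<in> H +> f x"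
      using H[OF h(1)] by (auto simp: a_r_coset_def')
    then show ?thesis
      using a_repr_independence[OF _ closed[OF x] a_subgroup] by simp
  qed
  then show ?thesis
    \<comment> \<open>All members of the union equal \<open>H +> f x\<close>, and the index set is
      nonempty since it contains \<open>x\<close>.\<close>
    unfolding coset_map_def using a_rcos_self[OF x] by blast
qed

text \<open>The double union is collapsed one variable at a time: the map is additive in each
  variable, and absorption on the two sides makes each partial map send \<open>H\<close> into
  \<open>H\<close>, so \<open>coset_map_rcos\<close> applies twice.\<close>

lemma coset_map2_rcos:
  assumes closed: "\<And>x y. \<lbrakk>x \<in> carrier G; y \<in> carrier G\<rbrakk> \<Longrightarrow> f x y \<in> carrier G"
    and add_left: "\<And>x y z. \<lbrakk>x \<in> carrier G; y \<in> carrier G; z \<in> carrier G\<rbrakk>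
      \<Longrightarrow> f (x \<oplus> y) z = f x z \<oplus> f y z"
    and add_right: "\<And>x y z. \<lbrakk>x \<in> carrier G; y \<in> carrier G; z \<in> carrier G\<rbrakk>
      \<Longrightarrow> f x (y \<oplus> z) = f x y \<oplus> f x z"
    and H_left: "\<And>h x. \<lbrakk>h \<in> H; x \<in> carrier G\<rbrakk> \<Longrightarrow> f h x \<in> H"
    and H_right: "\<And>h x. \<lbrakk>h \<in> H; x \<in> carrier G\<rbrakk> \<Longrightarrow> f x h \<in> H"
    and x: "x \<in> carrier G" and y: "y \<in> carrier G"
  shows "coset_map2 G H f (H +> x) (H +> y) = H +> f x y"
proof -
  have "coset_map2 G H f (H +> x) (H +> y) = (\<Union>u\<in>H +> x. coset_map G H (f u) (H +> y))"
    by (simp add: coset_map2_def coset_map_def)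
  also have "\<dots> = (\<Union>u\<in>H +> x. H +> f u y)"
  proof (rule SUP_cong[OF refl])
    fix u assume "u \<in> H +> x"
    then have "u \<in> carrier G"
      by (rule a_elemrcos_carrier[OF x])
    then show "coset_map G H (f u) (H +> y) = H +> f u y"
      using y by (intro coset_map_rcos) (auto simp: closed add_right H_right)
  qed
  also have "\<dots> = coset_map G H (\<lambda>u. f u y) (H +> x)"
    by (simp add: coset_map_def)
  also have "\<dots> = H +> f x y"
    using x y by (intro coset_map_rcos) (auto simp: closed add_left H_left)
  finally show ?thesis .
qed

end

lemma (in module) submodule_abelian_subgroup:
  assumes "submodule N R M"
  shows "abelian_subgroup N M"
  using abelian_subgroupI2[OF a_comm_group] submodule.axioms(1)[OF assms] by simp

text \<open>Collects what depends on the submodule alone; the product and the twisting maps enter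
  only as arbitrary bilinear and linear maps compatible with \<open>N\<close>.\<close>

locale quotient_by_submodule = module R M + submodule N R M for N and R (structure) and M (structure)
begin

sublocale N: abelian_subgroup N M
  by (rule submodule_abelian_subgroup) unfold_locales

abbreviation Q where "Q \<equiv> quotient_module M N"

lemma quotient_carrier [simp]: "carrier Q = a_rcosets\<^bsub>M\<^esub> N"
  and quotient_add [simp]: "add Q = set_add M"
  and quotient_zero [simp]: "\<zero>\<^bsub>Q\<^esub> = N"
  and quotient_smult: "c \<odot>\<^bsub>Q\<^esub> U = coset_map M N (smult M c) U"
  by (simp_all add: quotient_module_def)

lemma rcos_in_quotient [simp]: "x \<in> carrier M \<Longrightarrow> N +>\<^bsub>M\<^esub> x \<in> a_rcosets\<^bsub>M\<^esub> N"
  by (auto simp: A_RCOSETS_def')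

lemma rcos_add [simp]:
  "\<lbrakk>x \<in> carrier M; y \<in> carrier M\<rbrakk>
    \<Longrightarrow> (N +>\<^bsub>M\<^esub> x) <+>\<^bsub>M\<^esub> (N +>\<^bsub>M\<^esub> y) = N +>\<^bsub>M\<^esub> (x \<oplus>\<^bsub>M\<^esub> y)"
  by (rule N.a_rcos_sum)

text \<open>Scaling by \<open>c\<close> is additive and preserves the submodule, so it descends like
  any other such map.\<close>

lemma rcos_smult [simp]:
  "\<lbrakk>c \<in> carrier R; x \<in> carrier M\<rbrakk> \<Longrightarrow> c \<odot>\<^bsub>Q\<^esub> (N +>\<^bsub>M\<^esub> x) = N +>\<^bsub>M\<^esub> (c \<odot>\<^bsub>M\<^esub> x)"
  unfolding quotient_smult
  by (rule N.coset_map_rcos) (auto simp: smult_r_distr)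

text \<open>The zero of the quotient is the set \<open>N\<close> itself, so a computation ending in
  the coset of zero still needs this identification.\<close>

lemma rcos_zero: "N +>\<^bsub>M\<^esub> \<zero>\<^bsub>M\<^esub> = N"
  using N.a_subset by (rule M.a_coset_add_zero)

lemma quotient_abelian_group: "abelian_group Q"
proof (rule abelian_groupI)
  fix U assume "U \<in> carrier Q"
  then obtain x where x: "x \<in> carrier M" "U = N +>\<^bsub>M\<^esub> x"
    by (auto elim: N.a_rcosE)
  show "\<zero>\<^bsub>Q\<^esub> \<oplus>\<^bsub>Q\<^esub> U = U"
    using x by (simp add: N.rcosets_add_eq)
  have "(N +>\<^bsub>M\<^esub> (\<ominus>\<^bsub>M\<^esub> x)) \<oplus>\<^bsub>Q\<^esub> U = \<zero>\<^bsub>Q\<^esub>"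
    using x by (simp add: M.l_neg rcos_zero)
  then show "\<exists>V\<in>carrier Q. V \<oplus>\<^bsub>Q\<^esub> U = \<zero>\<^bsub>Q\<^esub>"
    using x by (intro bexI[of _ "N +>\<^bsub>M\<^esub> (\<ominus>\<^bsub>M\<^esub> x)"]) auto
qed (auto elim!: N.a_rcosE simp: N.a_subgroup_in_rcosets M.a_ac)

lemma quotient_is_module: "module R Q"
proof (rule moduleI)
  show "cring R" by unfold_locales
  show "abelian_group Q" by (rule quotient_abelian_group)
qed (auto elim!: N.a_rcosE simp: smult_l_distr smult_r_distr smult_assoc1)

lemma rcos_minus:
  assumes "x \<in> carrier M" "y \<in> carrier M"
  shows "(N +>\<^bsub>M\<^esub> x) \<ominus>\<^bsub>Q\<^esub> (N +>\<^bsub>M\<^esub> y) = N +>\<^bsub>M\<^esub> (x \<ominus>\<^bsub>M\<^esub> y)"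
proof -
  interpret Q: abelian_group Q by (rule quotient_abelian_group)
  \<comment> \<open>Negation in \<open>Q\<close> is determined by its addition, so it is found by
    uniqueness of inverses.\<close>
  have "\<ominus>\<^bsub>Q\<^esub> (N +>\<^bsub>M\<^esub> y) = N +>\<^bsub>M\<^esub> (\<ominus>\<^bsub>M\<^esub> y)"
    using assms
    by (intro Q.minus_equality) (simp_all add: M.l_neg rcos_zero)
  then show ?thesis
    using assms by (simp add: a_minus_def)
qed

lemma coset_map_linear:
  assumes "f \<in> linear_maps R M M" "\<And>x. x \<in> N \<Longrightarrow> f x \<in> N" "x \<in> carrier M"
  shows "coset_map M N f (N +>\<^bsub>M\<^esub> x) = N +>\<^bsub>M\<^esub> f x"
  using assms by (intro N.coset_map_rcos) (auto simp: linear_mapsD[OF assms(1)])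

lemma coset_map_in_linear_maps:
  assumes "f \<in> linear_maps R M M" "\<And>x. x \<in> N \<Longrightarrow> f x \<in> N"
  shows "coset_map M N f \<in> linear_maps R Q Q"
  by (rule linear_mapsI)
    (auto elim!: N.a_rcosE simp: coset_map_linear[OF assms] linear_mapsD[OF assms(1)])

lemma coset_map2_bilinear:
  assumes f: "f \<in> bilinear_maps R M M M"
    and "\<And>x y. \<lbrakk>x \<in> N; y \<in> carrier M\<rbrakk> \<Longrightarrow> f x y \<in> N"
    and "\<And>x y. \<lbrakk>x \<in> carrier M; y \<in> N\<rbrakk> \<Longrightarrow> f x y \<in> N"
    and "x \<in> carrier M" "y \<in> carrier M"
  shows "coset_map2 M N f (N +>\<^bsub>M\<^esub> x) (N +>\<^bsub>M\<^esub> y) = N +>\<^bsub>M\<^esub> f x y"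
  using assms(2-)
  by (intro N.coset_map2_rcos)
    (auto simp: linear_mapsD[OF bilinear_mapsD(1)[OF f]] linear_mapsD(2)[OF bilinear_mapsD(2)[OF f]])

lemma coset_map2_in_bilinear_maps:
  assumes f: "f \<in> bilinear_maps R M M M"
    and "\<And>x y. \<lbrakk>x \<in> N; y \<in> carrier M\<rbrakk> \<Longrightarrow> f x y \<in> N"
    and "\<And>x y. \<lbrakk>x \<in> carrier M; y \<in> N\<rbrakk> \<Longrightarrow> f x y \<in> N"
  shows "coset_map2 M N f \<in> bilinear_maps R Q Q Q"
  unfolding bilinear_maps_def
  by (auto intro!: linear_mapsI elim!: N.a_rcosE
      simp: coset_map2_bilinear[OF assms] linear_mapsD[OF bilinear_mapsD(1)[OF f]]
        linear_mapsD(2,3)[OF bilinear_mapsD(2)[OF f]])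

end

theorem proposition3p9:
  fixes K :: "('k, 'l) ring_scheme"
    and A :: "('k, 'a, 'm) module_scheme"
    and \<mu> :: "'a \<Rightarrow> 'a \<Rightarrow> 'a" and \<alpha> \<beta> :: "'a \<Rightarrow> 'a" and I :: "'a set"
  assumes alg_closed: "algebraically_closed K"
    and char_0: "\<forall>n::nat. 0 < n \<longrightarrow> [n] \<cdot>\<^bsub>K\<^esub> \<one>\<^bsub>K\<^esub> \<noteq> \<zero>\<^bsub>K\<^esub>"
    and jordan: "bihom_jordan_algebra K A \<mu> \<alpha> \<beta>"
    and ideal: "two_sided_bihom_ideal I K A \<mu> \<alpha> \<beta>"
  shows "bihom_jordan_algebra K (quotient_module A I)
           (coset_map2 A I \<mu>) (coset_map A I \<alpha>) (coset_map A I \<beta>) \<and>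
         (\<forall>x\<in>carrier A. \<forall>y\<in>carrier A.
           coset_map2 A I \<mu> (I +>\<^bsub>A\<^esub> x) (I +>\<^bsub>A\<^esub> y) = I +>\<^bsub>A\<^esub> \<mu> x y) \<and>
         (\<forall>x\<in>carrier A. coset_map A I \<alpha> (I +>\<^bsub>A\<^esub> x) = I +>\<^bsub>A\<^esub> \<alpha> x) \<and>
         (\<forall>x\<in>carrier A. coset_map A I \<beta> (I +>\<^bsub>A\<^esub> x) = I +>\<^bsub>A\<^esub> \<beta> x)"
proof -
  interpret J: bihom_jordan_algebra K A \<mu> \<alpha> \<beta> by (rule jordan)
  interpret I: two_sided_bihom_ideal I K A \<mu> \<alpha> \<beta> by (rule ideal)
  interpret quotient_by_submodule I K A by unfold_locales
  let ?m = "coset_map2 A I \<mu>" and ?a = "coset_map A I \<alpha>" and ?b = "coset_map A I \<beta>"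
  note closed [simp] = linear_mapsD(1)[OF bilinear_mapsD(1)[OF J.mu_bilinear]]
    linear_mapsD(1)[OF J.alpha_linear] linear_mapsD(1)[OF J.beta_linear]
  have m [simp]: "?m (I +>\<^bsub>A\<^esub> x) (I +>\<^bsub>A\<^esub> y) = I +>\<^bsub>A\<^esub> \<mu> x y"
    if "x \<in> carrier A" "y \<in> carrier A" for x y
    using coset_map2_bilinear[OF J.mu_bilinear I.mu_ideal_right I.mu_ideal_left that] .
  have a [simp]: "?a (I +>\<^bsub>A\<^esub> x) = I +>\<^bsub>A\<^esub> \<alpha> x" if "x \<in> carrier A" for x
    using coset_map_linear[OF J.alpha_linear I.alpha_closed that] .
  have b [simp]: "?b (I +>\<^bsub>A\<^esub> x) = I +>\<^bsub>A\<^esub> \<beta> x" if "x \<in> carrier A" for x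
    using coset_map_linear[OF J.beta_linear I.beta_closed that] .
  \<comment> \<open>The associator is composed of the product, the twisting maps and one
    subtraction, each of which commutes with the projection.\<close>
  have assoc: "bihom_associator Q ?m ?a ?b (I +>\<^bsub>A\<^esub> x) (I +>\<^bsub>A\<^esub> y) (I +>\<^bsub>A\<^esub> z)
      = I +>\<^bsub>A\<^esub> bihom_associator A \<mu> \<alpha> \<beta> x y z"
    if "x \<in> carrier A" "y \<in> carrier A" "z \<in> carrier A" for x y z
    using that by (simp add: bihom_associator_def rcos_minus)
  interpret QM: module K Q by (rule quotient_is_module)
  have "bihom_jordan_algebra K Q ?m ?a ?b"
  proof unfold_locales
    show "?m \<in> bilinear_maps K Q Q Q"
      by (rule coset_map2_in_bilinear_maps[OF J.mu_bilinear I.mu_ideal_right I.mu_ideal_left])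
    show "?a \<in> linear_maps K Q Q"
      by (rule coset_map_in_linear_maps[OF J.alpha_linear I.alpha_closed])
    show "?b \<in> linear_maps K Q Q"
      by (rule coset_map_in_linear_maps[OF J.beta_linear I.beta_closed])
  next
    fix U assume "U \<in> carrier Q"
    then show "?a (?b U) = ?b (?a U)"
      by (auto elim!: N.a_rcosE simp: J.alpha_beta_commute)
  next
    fix U V assume "U \<in> carrier Q" "V \<in> carrier Q"
    then obtain x y where xy: "x \<in> carrier A" "y \<in> carrier A"
      and [simp]: "U = I +>\<^bsub>A\<^esub> x" "V = I +>\<^bsub>A\<^esub> y"
      by (auto elim!: N.a_rcosE)
    show "?a (?m U V) = ?m (?a U) (?a V)" "?b (?m U V) = ?m (?b U) (?b V)"
      using xy by (simp_all add: J.alpha_mult J.beta_mult)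
    show "?m (?b U) (?a V) = ?m (?b V) (?a U)"
      using xy by (simp add: J.bihom_commutative)
    show "bihom_associator Q ?m ?a ?b (?m (?b (?b U)) (?a (?b U))) (?a (?a (?b V))) (?a (?a (?a U)))
        = \<zero>\<^bsub>Q\<^esub>"
      \<comment> \<open>The left side becomes the coset of the associator in \<open>A\<close>, which
        vanishes; its coset is \<open>I\<close>, the zero of \<open>Q\<close>.\<close>
      using xy by (simp add: assoc J.bihom_jordan_identity rcos_zero)
  qed
  then show ?thesis by simp
qed

end
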